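(* Let $n,d$ be positive integers. Let $\mu_1,\dots,\mu_n$ be absolutely continuous probability measures on $\mathbb{R}^d$ and let $y_1,\dots,y_n$ be $n$ distinct points (sites) in $\mathbb{R}^d$. Then there exist real weights $\lambda_1,\dots,\lambda_n$ such that the power diagram with sites $y_1,\dots,y_n$ and weights $\lambda_1,\dots,\lambda_n$ is an envy-free partition for $\mu_1,\dots,\mu_n$.
   Context: A measure on $\mathbb{R}^d$ is called absolutely continuous if it is absolutely continuous with respect to the Lebesgue measure. Write $[n]=\{1,\dots,n\}$. The power diagram (generalized Voronoi diagram) with distinct sites $y_1,\dots,y_n\in\mathbb{R}^d$ and weights $\lambda_1,\dots,\lambda_n\in\mathbb{R}$ is the partition $(C_1,\dots,C_n)$ of $\mathbb{R}^d$ given by $$C_j=\{z\in\mathbb{R}^d : \operatorname{dist}^2(z,y_j)-\lambda_j\le \operatorname{dist}^2(z,y_i)-\lambda_i \text{ for all } i\in[n]\}.$$ A partition $(C_1,\dots,C_n)$ of $\mathbb{R}^d$ is an envy-free partition for $\mu_1,\dots,\mu_n$ if there is a permutation $\pi:[n]\to[n]$ such that $\mu_i(C_{\pi(i)})\ge\mu_i(C_{\pi(i')})$ for all $i,i'\in[n]$. *)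

theory Defs
  imports "HOL-Analysis.Analysis" "HOL-Probability.Probability_Measure" "HOL-Combinatorics.Permutations"
begin

definition power_diagram ::
    "nat \<Rightarrow> (nat \<Rightarrow> real ^ 'd) \<Rightarrow> (nat \<Rightarrow> real) \<Rightarrow> nat \<Rightarrow> (real ^ 'd) set" where
  "power_diagram n y w j =
     {z. \<forall>i\<in>{1..n}. (dist z (y j))\<^sup>2 - w j \<le> (dist z (y i))\<^sup>2 - w i}"

text \<open>Cells of a power diagram are closed and share boundary points, so a partition
  is a measurable cover whose cells overlap pairwise only in Lebesgue null sets.
  Empty cells are allowed.\<close>

definition partition_Rd :: "nat \<Rightarrow> (nat \<Rightarrow> (real ^ 'd) set) \<Rightarrow> bool" where
  "partition_Rd n C \<longleftrightarrow>
     (\<forall>j\<in>{1..n}. C j \<in> sets borel) \<and>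
     (\<Union>j\<in>{1..n}. C j) = UNIV \<and>
     (\<forall>i\<in>{1..n}. \<forall>j\<in>{1..n}. i \<noteq> j \<longrightarrow> C i \<inter> C j \<in> null_sets lborel)"

definition envy_free_partition ::
    "nat \<Rightarrow> (nat \<Rightarrow> (real ^ 'd) measure) \<Rightarrow> (nat \<Rightarrow> (real ^ 'd) set) \<Rightarrow> bool" where
  "envy_free_partition n \<mu> C \<longleftrightarrow>
     partition_Rd n C \<and>
     (\<exists>\<pi>. \<pi> permutes {1..n} \<and>
       (\<forall>i\<in>{1..n}. \<forall>i'\<in>{1..n}. emeasure (\<mu> i) (C (\<pi> i)) \<ge> emeasure (\<mu> i) (C (\<pi> i'))))"

end

theory Submission
  imports Defs
begin

text \<open>
  Regard the weights as a point \<open>x\<close> of the cube \<open>[0,1]\<^sup>n\<close>, stretched by a large factor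
  \<open>L\<close>, and let \<open>m i j x\<close> be the value \<open>\<mu>\<^sub>i(C\<^sub>j)\<close>. Bisectors of distinct sites are
  hyperplanes, hence null sets, so the \<open>m i j\<close> are continuous and add up to \<open>1\<close> over \<open>j\<close>.
  If \<open>L\<close> is large, a cell whose coordinate is \<open>0\<close> while some other coordinate is \<open>1\<close> is worth
  at most \<open>1/(2n)\<close> to everybody, so it is nobody's favourite, not even approximately. From here on
  only these properties of \<open>m\<close> matter, and the problem is a colourful covering theorem in the
  style of Knaster, Kuratowski, Mazurkiewicz and Gale.
  
  Fix \<open>\<epsilon> > 0\<close> and let every \<open>i\<close> spread one unit of demand continuously over the cells that
  are within \<open>\<epsilon>\<close> of being best for \<open>i\<close>. Treat the coordinates of \<open>x\<close> as negated prices: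
  a cell with total demand below \<open>1\<close> should grow, one with demand above \<open>1\<close> should shrink. The
  fixed point principle for the cube (\<open>box_complementarity\<close>, from Kuhn's combinatorial lemma)
  yields a point where no coordinate can move in its desired direction. Undesirability of the
  cells at the bottom of the cube rules out the boundary effects, so each cell has demand
  exactly \<open>1\<close>. The demands then form a doubly stochastic matrix, and Hall's theorem provides a
  permutation through its positive entries: everybody gets a cell that is best up to \<open>\<epsilon>\<close>.
  
  There are finitely many permutations and the cube is compact, so letting \<open>\<epsilon>\<close> tend to \<open>0\<close>
  with a fixed permutation along a subsequence makes the assignment exactly envy-free.
\<close>

section \<open>Matchings in doubly stochastic matrices\<close>

text \<open>
  Rado's argument: as long as some \<open>S i\<close> contains two elements, one of them can be removed without
  destroying Hall's condition, and when all sets are singletons the condition says that they are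
  distinct. If neither \<open>x\<close> nor \<open>y\<close> could be removed from \<open>S i\<close>, there would be two index sets
  \<open>J1\<close> and \<open>J2\<close> containing \<open>i\<close> that violate the condition after the respective removal; counting
  the neighbours of \<open>J1 \<union> J2\<close> and of \<open>J1 \<inter> J2 - {i}\<close> shows that this is impossible.
\<close>

lemma hall_marriage:
  fixes S :: "'a \<Rightarrow> 'b set"
  assumes "finite A"
    and "\<And>i. i \<in> A \<Longrightarrow> finite (S i)"
    and "\<And>J. J \<subseteq> A \<Longrightarrow> card J \<le> card (\<Union>i\<in>J. S i)"
  shows "\<exists>f. inj_on f A \<and> (\<forall>i\<in>A. f i \<in> S i)"
  using assms(2,3)
proof (induction "\<Sum>i\<in>A. card (S i)" arbitrary: S rule: less_induct)
  case (less S)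
  note fin = less.prems(1) and hall = less.prems(2)
  show ?case
  proof (cases "\<exists>i\<in>A. \<exists>x\<in>S i. \<exists>y\<in>S i. x \<noteq> y")
    case False
    have "S i \<noteq> {}" if "i \<in> A" for i
      using hall[of "{i}"] that by auto
    then have "\<forall>i\<in>A. \<exists>x. x \<in> S i"
      by blast
    then obtain f where f: "\<And>i. i \<in> A \<Longrightarrow> f i \<in> S i"
      by metis
    with False have S: "S i = {f i}" if "i \<in> A" for i
      using that f[OF that] by auto
    have "inj_on f A"
    proof (rule inj_onI, rule ccontr)
      fix i j assume ij: "i \<in> A" "j \<in> A" "f i = f j" "i \<noteq> j"
      then have "(\<Union>l\<in>{i, j}. S l) = {f i}"
        using S by auto
      then show False
        using hall[of "{i, j}"] ij by simp
    qed
    then show ?thesis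
      using f by blast
  next
    case True
    then obtain i x y where i: "i \<in> A" and xy: "x \<in> S i" "y \<in> S i" "x \<noteq> y"
      by blast
    define S' where "S' = (\<lambda>v. S(i := S i - {v}))"
    have fin': "finite (S' v j)" if "j \<in> A" for v j
      using fin that by (auto simp: S'_def)
    have sub': "S' v j \<subseteq> S j" for v j
      by (auto simp: S'_def)
    have step: ?thesis if v: "v \<in> S i"
      and H: "\<And>J. J \<subseteq> A \<Longrightarrow> card J \<le> card (\<Union>j\<in>J. S' v j)" for v
    proof -
      have "(\<Sum>j\<in>A. card (S' v j)) < (\<Sum>j\<in>A. card (S j))"
      proof (rule sum_strict_mono_ex1)
        show "\<forall>j\<in>A. card (S' v j) \<le> card (S j)"
          using fin sub' by (blast intro: card_mono)
        have "card (S' v i) < card (S i)"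
          using card_Diff1_less[OF fin[OF i] v] by (simp only: S'_def fun_upd_same)
        then show "\<exists>j\<in>A. card (S' v j) < card (S j)"
          using i by blast
      qed fact
      from less.hyps[OF this fin' H] show ?thesis
        using sub' by blast
    qed
    show ?thesis
    proof (rule ccontr)
      assume neg: "\<not> ?thesis"
      have tight: "\<exists>J. J \<subseteq> A \<and> i \<in> J \<and> card (\<Union>j\<in>J. S' v j) < card J" if v: "v \<in> S i" for v
      proof -
        obtain J where J: "J \<subseteq> A" "card (\<Union>j\<in>J. S' v j) < card J"
          using step[OF v] neg by (meson not_le)
        have "i \<in> J"
        proof (rule ccontr)
          assume "i \<notin> J"
          then have "(\<Union>j\<in>J. S' v j) = (\<Union>j\<in>J. S j)"
            by (auto simp: S'_def)
          then show False
            using hall[OF J(1)] J(2) by simp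
        qed
        then show ?thesis
          using J by blast
      qed
      obtain J1 where J1: "J1 \<subseteq> A" "i \<in> J1" "card (\<Union>j\<in>J1. S' x j) < card J1"
        using tight[OF xy(1)] by blast
      obtain J2 where J2: "J2 \<subseteq> A" "i \<in> J2" "card (\<Union>j\<in>J2. S' y j) < card J2"
        using tight[OF xy(2)] by blast
      define U1 where "U1 = (\<Union>j\<in>J1. S' x j)"
      define U2 where "U2 = (\<Union>j\<in>J2. S' y j)"
      have fJ: "finite J1" "finite J2"
        using J1(1) J2(1) \<open>finite A\<close> finite_subset by auto
      have fU: "finite U1" "finite U2"
        using fJ fin' J1(1) J2(1) by (auto simp: U1_def U2_def)
      have "card (J1 \<union> J2) \<le> card (\<Union>j\<in>J1 \<union> J2. S j)"
        using J1 J2 by (intro hall) auto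
      also have "\<dots> \<le> card (U1 \<union> U2)"
      proof (rule card_mono)
        \<comment> \<open>\<open>x\<close> is missing only from \<open>U1\<close> and \<open>y\<close> only from \<open>U2\<close>, so together they lose nothing.\<close>
        show "(\<Union>j\<in>J1 \<union> J2. S j) \<subseteq> U1 \<union> U2"
          using J1(2) J2(2) xy(3) by (auto simp: U1_def U2_def S'_def split: if_splits)
      qed (use fU in auto)
      finally have un: "card (J1 \<union> J2) \<le> card (U1 \<union> U2)" .
      have "card (J1 \<inter> J2 - {i}) \<le> card (\<Union>j\<in>J1 \<inter> J2 - {i}. S j)"
        using J1 by (intro hall) auto
      also have "\<dots> \<le> card (U1 \<inter> U2)"
      proof (rule card_mono)
        show "(\<Union>j\<in>J1 \<inter> J2 - {i}. S j) \<subseteq> U1 \<inter> U2"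
          by (auto simp: U1_def U2_def S'_def)
      qed (use fU in auto)
      finally have "card (J1 \<inter> J2) \<le> card (U1 \<inter> U2) + 1"
        using J1(2) J2(2) fJ by (simp add: card_Diff_singleton)
      with un have "card J1 + card J2 \<le> card U1 + card U2 + 1"
        using card_Un_Int[OF fJ] card_Un_Int[OF fU] by linarith
      then show False
        using J1(3) J2(3) by (simp add: U1_def U2_def)
    qed
  qed
qed

text \<open>
  The rows in \<open>J\<close> carry total mass \<open>card J\<close>, all of it in the columns of their support; as each
  column holds mass \<open>1\<close>, there are at least \<open>card J\<close> such columns. This is Hall's condition.
\<close>

lemma doubly_stochastic_positive_permutation:
  fixes a :: "'a \<Rightarrow> 'a \<Rightarrow> real"
  assumes fin: "finite A"
    and nonneg: "\<And>i j. i \<in> A \<Longrightarrow> j \<in> A \<Longrightarrow> a i j \<ge> 0"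
    and rows: "\<And>i. i \<in> A \<Longrightarrow> (\<Sum>j\<in>A. a i j) = 1"
    and cols: "\<And>j. j \<in> A \<Longrightarrow> (\<Sum>i\<in>A. a i j) = 1"
  shows "\<exists>\<pi>. \<pi> permutes A \<and> (\<forall>i\<in>A. a i (\<pi> i) > 0)"
proof -
  define S where "S = (\<lambda>i. {j \<in> A. a i j > 0})"
  have "card J \<le> card (\<Union>i\<in>J. S i)" if J: "J \<subseteq> A" for J
  proof -
    let ?N = "\<Union>i\<in>J. S i"
    have N: "?N \<subseteq> A"
      by (auto simp: S_def)
    have "real (card J) = (\<Sum>i\<in>J. \<Sum>j\<in>A. a i j)"
      using J by (simp add: rows subset_iff)
    also have "\<dots> = (\<Sum>i\<in>J. \<Sum>j\<in>?N. a i j)"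
    proof (rule sum.cong[OF refl])
      fix i assume i: "i \<in> J"
      have "a i j = 0" if "j \<in> A - ?N" for j
        using that i J nonneg[of i j] by (force simp: S_def)
      then show "(\<Sum>j\<in>A. a i j) = (\<Sum>j\<in>?N. a i j)"
        using fin N by (intro sum.mono_neutral_right) auto
    qed
    also have "\<dots> = (\<Sum>j\<in>?N. \<Sum>i\<in>J. a i j)"
      by (rule sum.swap)
    also have "\<dots> \<le> (\<Sum>j\<in>?N. \<Sum>i\<in>A. a i j)"
      using J N nonneg fin by (intro sum_mono sum_mono2) auto
    also have "\<dots> = real (card ?N)"
      using N by (simp add: cols subset_iff)
    finally show ?thesis
      by simp
  qed
  then obtain f where f: "inj_on f A" "\<And>i. i \<in> A \<Longrightarrow> f i \<in> S i"
    using hall_marriage[OF fin, of S] fin by (auto simp: S_def)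
  define \<pi> where "\<pi> = (\<lambda>i. if i \<in> A then f i else i)"
  have "f ` A = A"
    using f fin by (intro endo_inj_surj) (auto simp: S_def)
  then have "bij_betw \<pi> A A"
    using f(1) by (auto simp: bij_betw_def \<pi>_def inj_on_def)
  then have "\<pi> permutes A"
    by (rule bij_imp_permutes) (simp add: \<pi>_def)
  moreover have "\<forall>i\<in>A. a i (\<pi> i) > 0"
    using f(2) by (auto simp: \<pi>_def S_def)
  ultimately show ?thesis
    by blast
qed

section \<open>A fixed point principle on the cube\<close>

lemma compact_unit_box: "compact {x :: nat \<Rightarrow> real. \<forall>i. 0 \<le> x i \<and> x i \<le> 1}"
proof -
  have "{x :: nat \<Rightarrow> real. \<forall>i. 0 \<le> x i \<and> x i \<le> 1} = (\<Pi>\<^sub>E i\<in>UNIV. {0..1})"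
    by (auto simp: PiE_def Pi_def)
  moreover have "compactin (product_topology (\<lambda>i::nat. euclidean :: real topology) UNIV)
     (\<Pi>\<^sub>E i\<in>UNIV. {0..1})"
    by (simp add: compactin_PiE)
  ultimately show ?thesis
    by (simp add: euclidean_product_topology)
qed

lemma tendsto_fun_iff:
  "(f \<longlongrightarrow> (l :: 'a \<Rightarrow> 'b::topological_space)) F \<longleftrightarrow> (\<forall>i. ((\<lambda>x. f x i) \<longlongrightarrow> l i) F)"
proof -
  have "limitin (product_topology (\<lambda>i. euclidean) UNIV) f l F \<longleftrightarrow> (\<forall>i. ((\<lambda>x. f x i) \<longlongrightarrow> l i) F)"
    by (subst limitin_componentwise) auto
  then show ?thesis
    by (simp add: euclidean_product_topology)
qed

text \<open>
  A form of Brouwer's theorem: if \<open>H i\<close> is the speed at which coordinate \<open>i\<close> wants to move, some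
  point of the cube is at rest when the motion is stopped at the faces. The dimension \<open>n\<close> is a
  term and not a type, so points of the cube are sequences, and the proof keeps their coordinates outside
  \<open>{1..n}\<close> at \<open>0\<close>.
  
  On the grid of mesh \<open>1/(k+1)\<close>, coordinate \<open>i\<close> of a grid point is labelled according to whether
  it wants to go up, with the labels on the faces forced to point into the cube. Kuhn's
  combinatorial lemma finds a small grid cell in which both labels occur for each coordinate, and
  any limit point of these cells is at rest.
\<close>

lemma box_complementarity:
  fixes H :: "nat \<Rightarrow> (nat \<Rightarrow> real) \<Rightarrow> real"
  assumes cont: "\<And>i. i \<in> {1..n} \<Longrightarrow> continuous_on UNIV (H i)"
  obtains x where "\<And>i. 0 \<le> x i \<and> x i \<le> 1"
    and "\<And>i. i \<in> {1..n} \<Longrightarrow> x i < 1 \<Longrightarrow> H i x \<le> 0"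
    and "\<And>i. i \<in> {1..n} \<Longrightarrow> x i > 0 \<Longrightarrow> H i x \<ge> 0"
proof -
  \<comment> \<open>Kuhn's lemma counts coordinates from \<open>0\<close>, hence the shift in \<open>P\<close>, which maps integer
      vectors to grid points.\<close>
  define P where "P = (\<lambda>k q i. if i \<in> {1..n} then real (q (i - 1)) / real (Suc k) else 0)"
  define up where "up = (\<lambda>x i. x i < 1 \<and> (x i = 0 \<or> H i x > 0))"
  define near where "near = (\<lambda>q r :: nat \<Rightarrow> nat. \<forall>j<n. q j \<le> r j \<and> r j \<le> q j + 1)"
  have "\<exists>q. (\<forall>i<n. q i < Suc k) \<and>
      (\<forall>i<n. \<exists>r s. near q r \<and> near q s \<and> up (P k r) (Suc i) \<and> \<not> up (P k s) (Suc i))" for k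
  proof -
    define label where "label = (\<lambda>q i. if up (P k q) (Suc i) then 0 else 1 :: nat)"
    have l1: "\<forall>x. (\<forall>i<n. x i \<le> Suc k) \<longrightarrow> (\<forall>i<n. label x i = 0 \<or> label x i = 1)"
      by (simp add: label_def)
    have l2: "\<forall>x. (\<forall>i<n. x i \<le> Suc k) \<longrightarrow> (\<forall>i<n. x i = 0 \<longrightarrow> label x i = 0)"
      by (simp add: label_def up_def P_def)
    have l3: "\<forall>x. (\<forall>i<n. x i \<le> Suc k) \<longrightarrow> (\<forall>i<n. x i = Suc k \<longrightarrow> label x i = 1)"
      by (simp add: label_def up_def P_def)
    obtain q where "\<forall>i<n. q i < Suc k"
      and q: "\<forall>i<n. \<exists>r s. near q r \<and> near q s \<and> label r i \<noteq> label s i"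
      unfolding near_def by (rule kuhn_lemma[OF zero_less_Suc l1 l2 l3])
    moreover have "\<exists>r s. near q r \<and> near q s \<and> up (P k r) (Suc i) \<and> \<not> up (P k s) (Suc i)"
      if "i < n" for i
    proof -
      obtain r s where rs: "near q r" "near q s" "label r i \<noteq> label s i"
        using q \<open>i < n\<close> by blast
      show ?thesis
      proof (cases "up (P k r) (Suc i)")
        case True
        then show ?thesis
          using rs by (auto simp: label_def split: if_splits)
      next
        case False
        then have "up (P k s) (Suc i)"
          using rs by (auto simp: label_def split: if_splits)
        then show ?thesis
          using rs False by blast
      qed
    qed
    ultimately show ?thesis
      by blast
  qed
  then obtain Q where Q: "\<And>k i. i < n \<Longrightarrow> Q k i < Suc k"
    and "\<And>k. \<forall>i<n. \<exists>r s. near (Q k) r \<and> near (Q k) s \<and> up (P k r) (Suc i) \<and> \<not> up (P k s) (Suc i)"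
    by metis
  then have "\<forall>k i. \<exists>r s. i < n \<longrightarrow>
      near (Q k) r \<and> near (Q k) s \<and> up (P k r) (Suc i) \<and> \<not> up (P k s) (Suc i)"
    by blast
  then obtain R T where RT: "\<And>k i. i < n \<Longrightarrow> near (Q k) (R k i) \<and> near (Q k) (T k i) \<and>
      up (P k (R k i)) (Suc i) \<and> \<not> up (P k (T k i)) (Suc i)"
    by metis
  have "P k (Q k) \<in> {x. \<forall>i. 0 \<le> x i \<and> x i \<le> 1}" for k
  proof -
    have "real (Q k (i - 1)) \<le> real (Suc k)" if "i \<in> {1..n}" for i
    proof -
      have "i - 1 < n"
        using that by auto
      then show ?thesis
        using Q[of "i - 1" k] by linarith
    qed
    then show ?thesis
      by (simp add: P_def)
  qed
  then obtain x \<rho> where x: "\<forall>i. 0 \<le> x i \<and> x i \<le> 1" and \<rho>: "strict_mono \<rho>"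
    and lim: "((\<lambda>k. P k (Q k)) \<circ> \<rho>) \<longlonglongrightarrow> x"
    using compact_unit_box unfolding compact_def by (smt (verit) mem_Collect_eq)
  \<comment> \<open>Every selection of vertices from the small cells has the same limit as the lower corners \<open>Q\<close>.\<close>
  have grid_lim: "(\<lambda>k. P (\<rho> k) (V (\<rho> k))) \<longlonglongrightarrow> x" if V: "\<And>k. near (Q k) (V k)" for V
    unfolding tendsto_fun_iff
  proof
    fix j
    have "(\<lambda>k. P (\<rho> k) (Q (\<rho> k)) j) \<longlonglongrightarrow> x j"
      using lim by (simp add: tendsto_fun_iff o_def)
    moreover have "(\<lambda>k. P (\<rho> k) (V (\<rho> k)) j - P (\<rho> k) (Q (\<rho> k)) j) \<longlonglongrightarrow> 0"
    proof (rule Lim_null_comparison)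
      have "norm (P k (V k) j - P k (Q k) j) \<le> 1 / real (Suc k)" for k
      proof (cases "j \<in> {1..n}")
        case True
        then have "j - 1 < n"
          by auto
        then have "Q k (j - 1) \<le> V k (j - 1)" "V k (j - 1) \<le> Q k (j - 1) + 1"
          using V[of k] unfolding near_def by auto
        then have "\<bar>real (V k (j - 1)) - real (Q k (j - 1))\<bar> \<le> 1"
          by linarith
        with True show ?thesis
          by (simp add: P_def divide_right_mono flip: diff_divide_distrib)
      next
        case False
        then have "P k q j = 0" for q
          unfolding P_def by (rule if_not_P)
        then show ?thesis
          by simp
      qed
      then show "\<forall>\<^sub>F k in sequentially. norm (P (\<rho> k) (V (\<rho> k)) j - P (\<rho> k) (Q (\<rho> k)) j)
          \<le> 1 / real (Suc (\<rho> k))"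
        by simp
      show "(\<lambda>k. 1 / real (Suc (\<rho> k))) \<longlonglongrightarrow> 0"
        using LIMSEQ_subseq_LIMSEQ[OF LIMSEQ_inverse_real_of_nat \<rho>]
        by (simp add: o_def inverse_eq_divide)
    qed
    ultimately show "(\<lambda>k. P (\<rho> k) (V (\<rho> k)) j) \<longlonglongrightarrow> x j"
      using tendsto_add by fastforce
  qed
  have val_lim: "(\<lambda>k. H i (P (\<rho> k) (V (\<rho> k)))) \<longlonglongrightarrow> H i x"
    if "i \<in> {1..n}" "\<And>k. near (Q k) (V k)" for i V
    using continuous_on_tendsto_compose[OF cont[OF that(1)] grid_lim[OF that(2)]] by simp
  show ?thesis
  proof
    fix i assume i: "i \<in> {1..n}"
    then obtain i' where i': "i = Suc i'" "i' < n"
      by (cases i) auto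
    have nR: "near (Q k) (R k i')" and nT: "near (Q k) (T k i')"
      and uR: "up (P k (R k i')) i" and uT: "\<not> up (P k (T k i')) i" for k
      using RT[of i' k] i' by auto
    \<comment> \<open>Near \<open>x\<close> the vertices \<open>T\<close> stay off the upper face, so their label is not forced and tells the
        sign of \<open>H i\<close>; likewise for \<open>R\<close> and the lower face.\<close>
    show "H i x \<le> 0" if "x i < 1"
    proof (rule tendsto_upperbound[OF val_lim[OF i nT]])
      have "(\<lambda>k. P (\<rho> k) (T (\<rho> k) i') i) \<longlonglongrightarrow> x i"
        using grid_lim[OF nT] by (simp add: tendsto_fun_iff)
      from order_tendstoD(2)[OF this that]
      show "\<forall>\<^sub>F k in sequentially. H i (P (\<rho> k) (T (\<rho> k) i')) \<le> 0"
      proof eventually_elim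
        case (elim k)
        then show ?case
          using uT[of "\<rho> k"] by (auto simp: up_def)
      qed
    qed simp
    show "H i x \<ge> 0" if "x i > 0"
    proof (rule tendsto_lowerbound[OF val_lim[OF i nR]])
      have "(\<lambda>k. P (\<rho> k) (R (\<rho> k) i') i) \<longlonglongrightarrow> x i"
        using grid_lim[OF nR] by (simp add: tendsto_fun_iff)
      from order_tendstoD(1)[OF this that]
      show "\<forall>\<^sub>F k in sequentially. H i (P (\<rho> k) (R (\<rho> k) i')) \<ge> 0"
      proof eventually_elim
        case (elim k)
        then show ?case
          using uR[of "\<rho> k"] by (auto simp: up_def)
      qed
    qed simp
  qed (use x in auto)
qed

section \<open>Envy-free choices for continuous valuations\<close>

text \<open>
  The product \<open>g i j\<close> is positive exactly when \<open>j\<close> is less than \<open>\<epsilon>\<close> short of every alternative, and it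
  is continuous; normalised, it is the demand \<open>a x i j\<close> of \<open>i\<close> for \<open>j\<close>. The point of the proof is
  to make the total demand \<open>F j\<close> equal to \<open>1\<close> for every \<open>j\<close>. Since the total demands add up to \<open>n\<close>,
  it is enough to have all of them at most \<open>1\<close> or all of them at least \<open>1\<close>.
\<close>

lemma approximate_envy_free_selection:
  fixes m :: "nat \<Rightarrow> nat \<Rightarrow> (nat \<Rightarrow> real) \<Rightarrow> real"
  assumes n: "n \<ge> 1"
    and cont: "\<And>i j. i \<in> {1..n} \<Longrightarrow> j \<in> {1..n} \<Longrightarrow> continuous_on UNIV (m i j)"
    and total: "\<And>i x. i \<in> {1..n} \<Longrightarrow> (\<Sum>j\<in>{1..n}. m i j x) = 1"
    and small: "\<And>i j k x. i \<in> {1..n} \<Longrightarrow> j \<in> {1..n} \<Longrightarrow> k \<in> {1..n} \<Longrightarrow>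
        x j = 0 \<Longrightarrow> x k = 1 \<Longrightarrow> m i j x \<le> 1 / (2 * real n)"
    and eps: "0 < \<epsilon>" "\<epsilon> \<le> 1 / (2 * real n)"
  shows "\<exists>x \<pi>. (\<forall>i. 0 \<le> x i \<and> x i \<le> 1) \<and> \<pi> permutes {1..n} \<and>
    (\<forall>i\<in>{1..n}. \<forall>j\<in>{1..n}. m i j x \<le> m i (\<pi> i) x + \<epsilon>)"
proof -
  define g where "g = (\<lambda>i j x. \<Prod>k\<in>{1..n}. max 0 (m i j x - m i k x + \<epsilon>))"
  define s where "s = (\<lambda>i x. \<Sum>j\<in>{1..n}. g i j x)"
  define a where "a = (\<lambda>x i j. g i j x / s i x)"
  have g_nonneg: "g i j x \<ge> 0" for i j x
    by (auto simp: g_def intro: prod_nonneg)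
  have g_posD: "m i k x < m i j x + \<epsilon>" if "g i j x > 0" "k \<in> {1..n}" for i j k x
  proof (rule ccontr)
    assume "\<not> ?thesis"
    then have "max 0 (m i j x - m i k x + \<epsilon>) = 0"
      by simp
    then have "g i j x = 0"
      unfolding g_def using that(2) by (intro prod_zero) auto
    then show False
      using that(1) by simp
  qed
  have s_pos: "s i x > 0" for i x
  proof -
    have "finite {1..n}" "{1..n} \<noteq> {}"
      using n by auto
    then obtain j where j: "j \<in> {1..n}" "\<And>k. k \<in> {1..n} \<Longrightarrow> m i k x \<le> m i j x"
      using Max_in[of "(\<lambda>k. m i k x) ` {1..n}"] Max_ge[of "(\<lambda>k. m i k x) ` {1..n}"] by fastforce
    have "g i j x > 0"
      unfolding g_def
    proof (rule prod_pos)
      fix k assume "k \<in> {1..n}"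
      then show "0 < max 0 (m i j x - m i k x + \<epsilon>)"
        using j(2)[of k] eps(1) by linarith
    qed
    then show ?thesis
      unfolding s_def using g_nonneg j(1) by (intro sum_pos2[of _ j]) auto
  qed
  have a_nonneg: "a x i j \<ge> 0" for x i j
    using g_nonneg s_pos[of i x] by (simp add: a_def less_imp_le)
  have a_row: "(\<Sum>j\<in>{1..n}. a x i j) = 1" for x i
    using s_pos[of i x] by (simp add: a_def s_def flip: sum_divide_distrib)
  have a_cont: "continuous_on UNIV (\<lambda>x. a x i j)" if "i \<in> {1..n}" "j \<in> {1..n}" for i j
  proof -
    have gc: "continuous_on UNIV (g i k)" if k: "k \<in> {1..n}" for k
      unfolding g_def using \<open>i \<in> {1..n}\<close> k
      by (intro continuous_intros cont) auto
    then have "continuous_on UNIV (s i)"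
      unfolding s_def by (intro continuous_intros)
    then show ?thesis
      unfolding a_def using gc[OF that(2)] s_pos by (intro continuous_on_divide) (auto simp: less_imp_neq[symmetric])
  qed
  define F where "F = (\<lambda>j x. \<Sum>i\<in>{1..n}. a x i j)"
  have F_cont: "continuous_on UNIV (\<lambda>x. 1 - F j x)" if "j \<in> {1..n}" for j
    unfolding F_def using that by (intro continuous_intros a_cont) auto
  have F_total: "(\<Sum>j\<in>{1..n}. F j x) = real n" for x
  proof -
    have "(\<Sum>j\<in>{1..n}. F j x) = (\<Sum>i\<in>{1..n}. \<Sum>j\<in>{1..n}. a x i j)"
      unfolding F_def by (rule sum.swap)
    then show ?thesis
      by (simp only: a_row) simp
  qed
  \<comment> \<open>Somebody offered \<open>n\<close> pieces worth \<open>1\<close> in total finds a piece worth \<open>1/n\<close>, which beats the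
      piece \<open>j\<close>, worth at most \<open>1/(2n)\<close>, by at least \<open>\<epsilon>\<close>.\<close>
  have F_zero: "F j x = 0" if jk: "j \<in> {1..n}" "k \<in> {1..n}" and x: "x j = 0" "x k = 1" for j k x
    unfolding F_def
  proof (rule sum.neutral, rule ballI)
    fix i assume i: "i \<in> {1..n}"
    have "\<exists>l\<in>{1..n}. m i l x \<ge> 1 / real n"
    proof (rule ccontr)
      assume "\<not> ?thesis"
      then have "(\<Sum>l\<in>{1..n}. m i l x) < (\<Sum>l\<in>{1..n}. 1 / real n)"
        using n by (intro sum_strict_mono) (auto simp: not_le)
      then show False
        using total[OF i, of x] n by simp
    qed
    then obtain l where l: "l \<in> {1..n}" "m i l x \<ge> 1 / real n"
      by blast
    have "1 / real n = 1 / (2 * real n) + 1 / (2 * real n)"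
      using n by (simp add: field_simps)
    then have "\<not> m i l x < m i j x + \<epsilon>"
      using l small[OF i jk x] eps by linarith
    then have "g i j x = 0"
      using g_posD[of i j x l] l g_nonneg[of i j x] by linarith
    then show "a x i j = 0"
      by (simp add: a_def)
  qed
  obtain x where x: "\<And>i. 0 \<le> x i \<and> x i \<le> 1"
    and up: "\<And>j. j \<in> {1..n} \<Longrightarrow> x j < 1 \<Longrightarrow> 1 - F j x \<le> 0"
    and down: "\<And>j. j \<in> {1..n} \<Longrightarrow> x j > 0 \<Longrightarrow> 1 - F j x \<ge> 0"
    using box_complementarity[of n "\<lambda>j x. 1 - F j x"] F_cont by blast
  have col: "F j x = 1" if j: "j \<in> {1..n}" for j
  proof (cases "\<exists>k\<in>{1..n}. x k = 1")
    case True
    then obtain k where k: "k \<in> {1..n}" "x k = 1"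
      by blast
    \<comment> \<open>A coordinate \<open>0\<close> would have demand \<open>0\<close> and hence want to rise, so all coordinates are positive.\<close>
    have le: "F l x \<le> 1" if "l \<in> {1..n}" for l
    proof -
      have "x l \<noteq> 0"
        using F_zero[of l k x] that k up[OF that] by force
      then show ?thesis
        using down[OF that] x[of l] by linarith
    qed
    have "(\<Sum>l\<in>{1..n}. 1 - F l x) = 0"
      using F_total by (simp add: sum_subtractf)
    then have "\<forall>l\<in>{1..n}. 1 - F l x = 0"
      using le by (subst (asm) sum_nonneg_eq_0_iff) auto
    then show ?thesis
      using j by simp
  next
    case False
    then have ge: "F l x \<ge> 1" if "l \<in> {1..n}" for l
      using up[OF that] x[of l] that by force
    have "(\<Sum>l\<in>{1..n}. F l x - 1) = 0"
      using F_total by (simp add: sum_subtractf)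
    then have "\<forall>l\<in>{1..n}. F l x - 1 = 0"
      using ge by (subst (asm) sum_nonneg_eq_0_iff) auto
    then show ?thesis
      using j by simp
  qed
  obtain \<pi> where \<pi>: "\<pi> permutes {1..n}" "\<forall>i\<in>{1..n}. a x i (\<pi> i) > 0"
    using doubly_stochastic_positive_permutation[of "{1..n}" "a x"] a_nonneg a_row col
    unfolding F_def by auto
  have "m i j x \<le> m i (\<pi> i) x + \<epsilon>" if "i \<in> {1..n}" "j \<in> {1..n}" for i j
  proof -
    have "g i (\<pi> i) x > 0"
    proof -
      have "0 < g i (\<pi> i) x / s i x"
        using \<pi>(2) that(1) by (simp add: a_def)
      then show ?thesis
        using s_pos[of i x] by (auto simp: zero_less_divide_iff)
    qed
    then show ?thesis
      using g_posD that(2) by (simp add: less_imp_le)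
  qed
  with x \<pi>(1) show ?thesis
    by blast
qed

text \<open>
  A colourful covering theorem: the closed sets of points where \<open>j\<close> is a favourite of \<open>i\<close> cover the
  cube for each \<open>i\<close>, and some point lies in one set per \<open>i\<close>, with all \<open>j\<close> used. The smallness
  condition is the boundary condition that makes it true; the constant \<open>1/(2n)\<close> only has to be
  smaller than the value \<open>1/n\<close> of an average piece.
\<close>

lemma envy_free_selection:
  fixes m :: "nat \<Rightarrow> nat \<Rightarrow> (nat \<Rightarrow> real) \<Rightarrow> real"
  assumes n: "n \<ge> 1"
    and cont: "\<And>i j. i \<in> {1..n} \<Longrightarrow> j \<in> {1..n} \<Longrightarrow> continuous_on UNIV (m i j)"
    and total: "\<And>i x. i \<in> {1..n} \<Longrightarrow> (\<Sum>j\<in>{1..n}. m i j x) = 1"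
    and small: "\<And>i j k x. i \<in> {1..n} \<Longrightarrow> j \<in> {1..n} \<Longrightarrow> k \<in> {1..n} \<Longrightarrow>
        x j = 0 \<Longrightarrow> x k = 1 \<Longrightarrow> m i j x \<le> 1 / (2 * real n)"
  shows "\<exists>x \<pi>. \<pi> permutes {1..n} \<and> (\<forall>i\<in>{1..n}. \<forall>j\<in>{1..n}. m i j x \<le> m i (\<pi> i) x)"
proof -
  define e where "e = (\<lambda>k. 1 / (2 * real n) * (1 / real (Suc k)))"
  have e_pos: "0 < e k" and e_le: "e k \<le> 1 / (2 * real n)" for k
    using n by (auto simp: e_def divide_simps)
  have e_lim: "e \<longlonglongrightarrow> 0"
    unfolding e_def using tendsto_mult_right_zero[OF LIMSEQ_inverse_real_of_nat, of "1 / (2 * real n)"]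
    by (simp add: inverse_eq_divide)
  have "\<forall>k. \<exists>x \<pi>. (\<forall>i. 0 \<le> x i \<and> x i \<le> 1) \<and> \<pi> permutes {1..n} \<and>
      (\<forall>i\<in>{1..n}. \<forall>j\<in>{1..n}. m i j x \<le> m i (\<pi> i) x + e k)"
    by (intro allI approximate_envy_free_selection[OF n cont total small e_pos e_le])
  then obtain X q where X: "\<And>k i. 0 \<le> X k i \<and> X k i \<le> 1"
    and q: "\<And>k. q k permutes {1..n}"
    and near: "\<And>k i j. i \<in> {1..n} \<Longrightarrow> j \<in> {1..n} \<Longrightarrow> m i j (X k) \<le> m i (q k i) (X k) + e k"
    unfolding choice_iff by blast
  have "finite (range q)"
    by (rule finite_subset[OF _ finite_permutations[of "{1..n}"]]) (use q in auto)
  then obtain k0 where inf: "infinite {k. q k = q k0}"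
    using pigeonhole_infinite[of UNIV q] by auto
  define \<rho> where "\<rho> = enumerate {k. q k = q k0}"
  have \<rho>: "strict_mono \<rho>" "\<And>k. q (\<rho> k) = q k0"
    using enumerate_in_set[OF inf] strict_mono_enumerate[OF inf] by (auto simp: \<rho>_def)
  have "\<forall>k. (X \<circ> \<rho>) k \<in> {x. \<forall>i. 0 \<le> x i \<and> x i \<le> 1}"
    using X by simp
  then obtain x \<sigma> where \<sigma>: "strict_mono \<sigma>" and lim: "(X \<circ> \<rho> \<circ> \<sigma>) \<longlonglongrightarrow> x"
    using compact_unit_box unfolding compact_def by blast
  have "m i j x \<le> m i (q k0 i) x" if ij: "i \<in> {1..n}" "j \<in> {1..n}" for i j
  proof -
    have val_lim: "(\<lambda>k. m i l ((X \<circ> \<rho> \<circ> \<sigma>) k)) \<longlonglongrightarrow> m i l x" if "l \<in> {1..n}" for l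
      using continuous_on_tendsto_compose[OF cont[OF ij(1) that] lim] by simp
    have \<pi>i: "q k0 i \<in> {1..n}"
      using permutes_in_image[OF q] ij(1) by blast
    have "(\<lambda>k. e ((\<rho> \<circ> \<sigma>) k)) \<longlonglongrightarrow> 0"
      using LIMSEQ_subseq_LIMSEQ[OF e_lim strict_mono_o[OF \<rho>(1) \<sigma>]] by (simp add: o_def)
    from tendsto_add[OF val_lim[OF \<pi>i] this]
    have "(\<lambda>k. m i (q k0 i) ((X \<circ> \<rho> \<circ> \<sigma>) k) + e ((\<rho> \<circ> \<sigma>) k)) \<longlonglongrightarrow> m i (q k0 i) x"
      by simp
    then show ?thesis
    proof (rule LIMSEQ_le[OF val_lim[OF ij(2)]], intro exI allI impI)
      fix k
      show "m i j ((X \<circ> \<rho> \<circ> \<sigma>) k) \<le> m i (q k0 i) ((X \<circ> \<rho> \<circ> \<sigma>) k) + e ((\<rho> \<circ> \<sigma>) k)"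
        using near[OF ij, of "\<rho> (\<sigma> k)"] \<rho>(2) by simp
    qed
  qed
  then show ?thesis
    using q by blast
qed

section \<open>Measures of the cells of power diagrams\<close>

lemma dist_square_diff:
  fixes a b z :: "'a::real_inner"
  shows "(dist z a)\<^sup>2 - (dist z b)\<^sup>2 = 2 * ((b - a) \<bullet> z) + (a \<bullet> a - b \<bullet> b)"
  by (simp add: dist_norm power2_norm_eq_inner algebra_simps inner_commute)

lemma power_bisector_null:
  fixes a b :: "'a::euclidean_space"
  assumes "a \<noteq> b"
  shows "{z. (dist z a)\<^sup>2 - s = (dist z b)\<^sup>2 - t} \<in> null_sets lborel"
proof -
  let ?B = "{z. (dist z a)\<^sup>2 - s = (dist z b)\<^sup>2 - t}"
  have "?B = {z. (b - a) \<bullet> z = (s - t - (a \<bullet> a - b \<bullet> b)) / 2}"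
  proof (intro Collect_cong)
    fix z
    show "(dist z a)\<^sup>2 - s = (dist z b)\<^sup>2 - t \<longleftrightarrow> (b - a) \<bullet> z = (s - t - (a \<bullet> a - b \<bullet> b)) / 2"
      using dist_square_diff[of z a b] by (simp only: field_simps) linarith
  qed
  then have "negligible ?B"
    using negligible_hyperplane[of "b - a"] assms by (simp only: right_minus_eq) blast
  moreover have "closed ?B"
    by (intro closed_Collect_eq continuous_intros)
  ultimately show ?thesis
    by (simp add: negligible_iff_null_sets null_sets_completion_iff)
qed

lemma closed_power_diagram: "closed (power_diagram n y w j)"
proof -
  have "power_diagram n y w j =
      (\<Inter>i\<in>{1..n}. {z. (dist z (y j))\<^sup>2 - w j \<le> (dist z (y i))\<^sup>2 - w i})"
    by (auto simp: power_diagram_def)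
  moreover have "closed \<dots>"
    by (intro closed_INT ballI closed_Collect_le continuous_intros)
  ultimately show ?thesis
    by simp
qed

lemma power_diagram_cover:
  assumes "n \<ge> 1"
  shows "(\<Union>j\<in>{1..n}. power_diagram n y w j) = UNIV"
proof -
  have "\<exists>j\<in>{1..n}. z \<in> power_diagram n y w j" for z
  proof -
    let ?h = "\<lambda>i. (dist z (y i))\<^sup>2 - w i"
    have "Min (?h ` {1..n}) \<in> ?h ` {1..n}"
      using assms by (intro Min_in) auto
    then obtain j where "j \<in> {1..n}" "?h j = Min (?h ` {1..n})"
      by force
    then show ?thesis
      by (auto simp: power_diagram_def intro!: bexI[of _ j])
  qed
  then show ?thesis
    by blast
qed

lemma power_diagram_overlap_null:
  assumes "inj_on y {1..n}" "i \<in> {1..n}" "j \<in> {1..n}" "i \<noteq> j"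
  shows "power_diagram n y w i \<inter> power_diagram n y w j \<in> null_sets lborel"
proof (rule null_sets_subset)
  show "{z. (dist z (y i))\<^sup>2 - w i = (dist z (y j))\<^sup>2 - w j} \<in> null_sets lborel"
    using assms by (intro power_bisector_null) (auto dest: inj_onD)
  show "power_diagram n y w i \<inter> power_diagram n y w j \<in> sets lborel"
    by (simp add: borel_closed closed_Int closed_power_diagram)
  show "power_diagram n y w i \<inter> power_diagram n y w j
      \<subseteq> {z. (dist z (y i))\<^sup>2 - w i = (dist z (y j))\<^sup>2 - w j}"
    using assms by (force simp: power_diagram_def)
qed

lemma partition_power_diagram:
  assumes "n \<ge> 1" "inj_on y {1..n}"
  shows "partition_Rd n (power_diagram n y w)"
  using power_diagram_cover[OF assms(1)] power_diagram_overlap_null[OF assms(2)]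
  by (simp add: partition_Rd_def borel_closed closed_power_diagram)

lemma sum_measure_power_diagram:
  assumes "prob_space M" and M: "sets M = sets borel" and ac: "absolutely_continuous lborel M"
    and n: "n \<ge> 1" and y: "inj_on y {1..n}"
  shows "(\<Sum>j\<in>{1..n}. measure M (power_diagram n y w j)) = 1"
proof -
  interpret prob_space M by fact
  have "measure M (\<Union>j\<in>{1..n}. power_diagram n y w j)
      = (\<Sum>j\<in>{1..n}. measure M (power_diagram n y w j))"
  proof (rule measure_UNION_AE)
    show "pairwise (\<lambda>i j. AE z in M. z \<notin> power_diagram n y w i \<or> z \<notin> power_diagram n y w j) {1..n}"
    proof (rule pairwiseI)
      fix i j assume "i \<in> {1..n}" "j \<in> {1..n}" "i \<noteq> j"
      then have "power_diagram n y w i \<inter> power_diagram n y w j \<in> null_sets M"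
        using power_diagram_overlap_null[OF y, of i j w] ac by (auto simp: absolutely_continuous_def)
      from AE_not_in[OF this]
      show "AE z in M. z \<notin> power_diagram n y w i \<or> z \<notin> power_diagram n y w j"
        by simp
    qed
  qed (auto simp: M borel_closed closed_power_diagram fmeasurable_eq_sets)
  moreover have "space M = UNIV"
    using sets_eq_imp_space_eq[OF M] by simp
  ultimately show ?thesis
    using prob_space by (simp only: power_diagram_cover[OF n])
qed

text \<open>
  Off the bisectors between the site \<open>y j\<close> and the other sites, membership in cell \<open>j\<close> is decided by strict
  inequalities and is therefore stable under small changes of the weights. The bisectors are null
  sets, so the indicator functions converge almost everywhere and dominated convergence applies.
\<close>

lemma continuous_measure_power_diagram:
  assumes "finite_measure M" and M: "sets M = sets borel" and ac: "absolutely_continuous lborel M"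
    and y: "inj_on y {1..n}" and j: "j \<in> {1..n}"
  shows "continuous_on UNIV (\<lambda>w. measure M (power_diagram n y w j))"
proof -
  interpret finite_measure M by fact
  have sets: "power_diagram n y w j \<in> sets M" for w
    by (simp add: M borel_closed closed_power_diagram)
  have "(\<lambda>k. measure M (power_diagram n y (W k) j)) \<longlonglongrightarrow> measure M (power_diagram n y w j)"
    if W: "W \<longlonglongrightarrow> w" for W w
  proof -
    have Wi: "(\<lambda>k. W k i) \<longlonglongrightarrow> w i" for i
      using continuous_on_tendsto_compose[OF continuous_on_product_coordinates W] by simp
    have "AE z in M. \<forall>i\<in>{1..n} - {j}. (dist z (y j))\<^sup>2 - w j \<noteq> (dist z (y i))\<^sup>2 - w i"
    proof (intro AE_finite_allI)
      fix i assume "i \<in> {1..n} - {j}"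
      then have "{z. (dist z (y j))\<^sup>2 - w j = (dist z (y i))\<^sup>2 - w i} \<in> null_sets lborel"
        using y j by (intro power_bisector_null) (auto dest: inj_onD)
      then have "{z. (dist z (y j))\<^sup>2 - w j = (dist z (y i))\<^sup>2 - w i} \<in> null_sets M"
        using ac by (auto simp: absolutely_continuous_def)
      from AE_not_in[OF this]
      show "AE z in M. (dist z (y j))\<^sup>2 - w j \<noteq> (dist z (y i))\<^sup>2 - w i"
        by simp
    qed simp
    then have "AE z in M. (\<lambda>k. indicator (power_diagram n y (W k) j) z :: real)
        \<longlonglongrightarrow> indicator (power_diagram n y w j) z"
    proof eventually_elim
      case (elim z)
      have lims: "(\<lambda>k. (dist z (y i))\<^sup>2 - W k i) \<longlonglongrightarrow> (dist z (y i))\<^sup>2 - w i" for i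
        by (intro tendsto_intros Wi)
      have "\<forall>\<^sub>F k in sequentially. z \<in> power_diagram n y (W k) j \<longleftrightarrow> z \<in> power_diagram n y w j"
      proof (cases "z \<in> power_diagram n y w j")
        case True
        have "\<forall>\<^sub>F k in sequentially. \<forall>i\<in>{1..n}. (dist z (y j))\<^sup>2 - W k j \<le> (dist z (y i))\<^sup>2 - W k i"
        proof (intro eventually_ball_finite ballI)
          fix i assume i: "i \<in> {1..n}"
          show "\<forall>\<^sub>F k in sequentially. (dist z (y j))\<^sup>2 - W k j \<le> (dist z (y i))\<^sup>2 - W k i"
          proof (cases "i = j")
            case False
            then have "(dist z (y j))\<^sup>2 - w j < (dist z (y i))\<^sup>2 - w i"
              using True elim i by (simp add: power_diagram_def order_less_le)
            from order_tendstoD(1)[OF tendsto_diff[OF lims lims], of 0 i j] this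
            have "\<forall>\<^sub>F k in sequentially. 0 < ((dist z (y i))\<^sup>2 - W k i) - ((dist z (y j))\<^sup>2 - W k j)"
              by simp
            then show ?thesis
              by eventually_elim simp
          qed simp
        qed simp
        then show ?thesis
          by eventually_elim (use True in \<open>simp add: power_diagram_def\<close>)
      next
        case False
        then obtain i where i: "i \<in> {1..n}" "(dist z (y i))\<^sup>2 - w i < (dist z (y j))\<^sup>2 - w j"
          by (auto simp: power_diagram_def not_le)
        from order_tendstoD(1)[OF tendsto_diff[OF lims lims], of 0 j i] i(2)
        have "\<forall>\<^sub>F k in sequentially. 0 < ((dist z (y j))\<^sup>2 - W k j) - ((dist z (y i))\<^sup>2 - W k i)"
          by simp
        then show ?thesis
          by eventually_elim (use False i(1) in \<open>force simp: power_diagram_def\<close>)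
      qed
      then show ?case
        by (intro tendsto_eventually) (auto elim!: eventually_mono simp: indicator_def)
    qed
    then have "(\<lambda>k. integral\<^sup>L M (indicator (power_diagram n y (W k) j) :: _ \<Rightarrow> real))
        \<longlonglongrightarrow> integral\<^sup>L M (indicator (power_diagram n y w j))"
      by (intro integral_dominated_convergence[where w = "\<lambda>_. 1"])
         (auto simp: sets borel_measurable_indicator)
    then show ?thesis
      using sets by simp
  qed
  then show ?thesis
    by (simp add: continuous_on_sequentially o_def)
qed

text \<open>
  If \<open>w k\<close> exceeds \<open>w j\<close> by at least \<open>N\<close>, cell \<open>j\<close> lies in the set \<open>A N\<close> of points that are nearer
  to \<open>y j\<close> than to \<open>y k\<close> by at least \<open>N\<close> in squared distance. These sets shrink to the empty set. The bound is uniform in \<open>w\<close>, which allows a single choice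
  of the scaling factor of the weights.
\<close>

lemma measure_power_diagram_small:
  assumes "finite_measure M" and M: "sets M = sets borel"
    and k: "k \<in> {1..n}" and e: "e > 0"
  shows "\<forall>\<^sub>F L in at_top. \<forall>w. w k - w j \<ge> L \<longrightarrow> measure M (power_diagram n y w j) \<le> e"
proof -
  interpret finite_measure M by fact
  define A where "A = (\<lambda>N::nat. {z. (dist z (y j))\<^sup>2 - (dist z (y k))\<^sup>2 \<le> - real N})"
  have A_sets: "A N \<in> sets M" for N
    unfolding A_def M by (intro borel_closed closed_Collect_le continuous_intros)
  have "decseq A"
    by (auto simp: decseq_def A_def)
  moreover have "(\<Inter>N. A N) = {}"
  proof -
    have "\<exists>N. z \<notin> A N" for z
      using reals_Archimedean2[of "(dist z (y k))\<^sup>2 - (dist z (y j))\<^sup>2"]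
      by (auto simp: A_def not_le algebra_simps)
    then show ?thesis
      by blast
  qed
  ultimately have "(\<lambda>N. measure M (A N)) \<longlonglongrightarrow> 0"
    using finite_Lim_measure_decseq[of A] A_sets by auto
  then obtain N where N: "measure M (A N) < e"
    using order_tendstoD(2)[OF _ e] by (metis eventually_happens' sequentially_bot)
  have "\<forall>w. w k - w j \<ge> L \<longrightarrow> measure M (power_diagram n y w j) \<le> e" if L: "L \<ge> real N" for L
  proof (intro allI impI)
    fix w :: "nat \<Rightarrow> real" assume "w k - w j \<ge> L"
    then have "power_diagram n y w j \<subseteq> A N"
      using k L by (force simp: power_diagram_def A_def)
    then have "measure M (power_diagram n y w j) \<le> measure M (A N)"
      using A_sets by (intro finite_measure_mono)
    then show "measure M (power_diagram n y w j) \<le> e"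
      using N by simp
  qed
  then show ?thesis
    by (auto simp: eventually_at_top_linorder)
qed

section \<open>Envy-free power diagrams\<close>

theorem corollary3p4:
  fixes n :: nat
    and \<mu> :: "nat \<Rightarrow> (real ^ 'd) measure"
    and y :: "nat \<Rightarrow> real ^ 'd"
  assumes "n \<ge> 1"
    and "\<And>i. i \<in> {1..n} \<Longrightarrow> prob_space (\<mu> i)"
    and "\<And>i. i \<in> {1..n} \<Longrightarrow> sets (\<mu> i) = sets borel"
    and "\<And>i. i \<in> {1..n} \<Longrightarrow> absolutely_continuous lborel (\<mu> i)"
    and "inj_on y {1..n}"
  shows "\<exists>w :: nat \<Rightarrow> real. envy_free_partition n \<mu> (power_diagram n y w)"
proof -
  have fm: "finite_measure (\<mu> i)" if "i \<in> {1..n}" for i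
    using assms(2)[OF that] by (rule prob_space.finite_measure)
  have "\<forall>\<^sub>F L in at_top. \<forall>i\<in>{1..n}. \<forall>j\<in>{1..n}. \<forall>k\<in>{1..n}. \<forall>w. w k - w j \<ge> L \<longrightarrow>
      measure (\<mu> i) (power_diagram n y w j) \<le> 1 / (2 * real n)"
    using fm assms(1,3)
    by (intro eventually_ball_finite ballI measure_power_diagram_small) auto
  then obtain L where L: "\<And>i j k w. i \<in> {1..n} \<Longrightarrow> j \<in> {1..n} \<Longrightarrow> k \<in> {1..n} \<Longrightarrow>
      w k - w j \<ge> L \<Longrightarrow> measure (\<mu> i) (power_diagram n y w j) \<le> 1 / (2 * real n)"
    using eventually_happens'[OF trivial_limit_at_top_linorder] by blast
  define m where "m = (\<lambda>i j x. measure (\<mu> i) (power_diagram n y (\<lambda>l. L * x l) j))"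
  have "\<exists>x \<pi>. \<pi> permutes {1..n} \<and> (\<forall>i\<in>{1..n}. \<forall>j\<in>{1..n}. m i j x \<le> m i (\<pi> i) x)"
  proof (rule envy_free_selection[OF assms(1)])
    fix i j assume i: "i \<in> {1..n}" and j: "j \<in> {1..n}"
    have "continuous_on UNIV (\<lambda>(x :: nat \<Rightarrow> real) l. L * x l)"
      by (intro continuous_on_coordinatewise_then_product continuous_intros continuous_on_product_coordinates)
    then show "continuous_on UNIV (m i j)"
      unfolding m_def
      by (rule continuous_on_compose2[OF continuous_measure_power_diagram[OF fm[OF i]
            assms(3,4)[OF i] assms(5) j]]) auto
  next
    fix i x assume "i \<in> {1..n}"
    then show "(\<Sum>j\<in>{1..n}. m i j x) = 1"
      unfolding m_def using assms by (intro sum_measure_power_diagram) auto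
  next
    fix i j k :: nat and x :: "nat \<Rightarrow> real"
    assume "i \<in> {1..n}" "j \<in> {1..n}" "k \<in> {1..n}" "x j = 0" "x k = 1"
    then show "m i j x \<le> 1 / (2 * real n)"
      unfolding m_def using L[of i j k "\<lambda>l. L * x l"] by simp
  qed
  then obtain x \<pi> where \<pi>: "\<pi> permutes {1..n}"
    and best: "\<And>i j. i \<in> {1..n} \<Longrightarrow> j \<in> {1..n} \<Longrightarrow> m i j x \<le> m i (\<pi> i) x"
    by blast
  have "emeasure (\<mu> i) (power_diagram n y (\<lambda>l. L * x l) (\<pi> i'))
      \<le> emeasure (\<mu> i) (power_diagram n y (\<lambda>l. L * x l) (\<pi> i))"
    if i: "i \<in> {1..n}" and i': "i' \<in> {1..n}" for i i'
  proof -
    interpret finite_measure "\<mu> i" by (rule fm[OF i])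
    show ?thesis
      using best[OF i, of "\<pi> i'"] permutes_in_image[OF \<pi>] i'
      by (simp add: m_def emeasure_eq_measure)
  qed
  then show ?thesis
    using partition_power_diagram[OF assms(1,5)] \<pi> unfolding envy_free_partition_def by blast
qed

end
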